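(* Let $L$ be an arbitrary formal language over a finite alphabet and let $d = lev_{\gamma,\theta}$ be a generalized Levenshtein distance with insertion/removal weight $\gamma>0$ and replacement weight $\theta>0$ such that $\theta < 2\gamma$. Then there exists $m \in \mathbb{N}$ such that for every $\phi \in Isom_d(L)$ and every $w \in L$ one has $\big||\phi(w)| - |w|\big| \leq m$.
   Context: For a finite alphabet $A$, $A^*$ is the set of all finite words over $A$ (including the empty word), and a formal language is a subset $L\subset A^*$; $|w|$ is the length of the word $w$. For real $\gamma,\theta>0$ the generalized Levenshtein distance with insertion (equivalently, removal) weight $\gamma$ and replacement weight $\theta$ is $$lev_{\gamma,\theta}(u,v)=\min\{\gamma n+\theta m \mid u \text{ can be transformed into } v \text{ by } n \text{ insertions or deletions of single characters and } m \text{ replacements of single characters}\}$$ where the intermediate words are arbitrary words of $A^*$. It is a metric on $A^*$. $Isom_d(L)$ is the group (under composition) of all bijections $\phi:L\to L$ with $d(\phi(u),\phi(v))=d(u,v)$ for all $u,v\in L$. *)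

theory Defs
  imports Complex_Main "HOL-Algebra.Bij"
begin

inductive indel :: "'a set \<Rightarrow> 'a list \<Rightarrow> 'a list \<Rightarrow> bool" for A :: "'a set" where
  insertion: "xs \<in> lists A \<Longrightarrow> ys \<in> lists A \<Longrightarrow> a \<in> A \<Longrightarrow> indel A (xs @ ys) (xs @ a # ys)"
| deletion: "xs \<in> lists A \<Longrightarrow> ys \<in> lists A \<Longrightarrow> a \<in> A \<Longrightarrow> indel A (xs @ a # ys) (xs @ ys)"

inductive replacement :: "'a set \<Rightarrow> 'a list \<Rightarrow> 'a list \<Rightarrow> bool" for A :: "'a set" where
  "xs \<in> lists A \<Longrightarrow> ys \<in> lists A \<Longrightarrow> a \<in> A \<Longrightarrow> b \<in> A
    \<Longrightarrow> replacement A (xs @ a # ys) (xs @ b # ys)"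

(* transforms A u n m v: some sequence of n insertions or deletions and m replacements, in any
   order and with all intermediate words in lists A, leads from u to v. *)
inductive transforms :: "'a set \<Rightarrow> 'a list \<Rightarrow> nat \<Rightarrow> nat \<Rightarrow> 'a list \<Rightarrow> bool"
  for A :: "'a set" and u :: "'a list" where
  refl: "u \<in> lists A \<Longrightarrow> transforms A u 0 0 u"
| indel: "transforms A u n m v \<Longrightarrow> indel A v w \<Longrightarrow> transforms A u (Suc n) m w"
| replacement: "transforms A u n m v \<Longrightarrow> replacement A v w \<Longrightarrow> transforms A u n (Suc m) w"

(* LEAST on the reals is only meaningful when the minimum is attained; see lev_attained. *)
definition lev :: "'a set \<Rightarrow> real \<Rightarrow> real \<Rightarrow> 'a list \<Rightarrow> 'a list \<Rightarrow> real" where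
  "lev A \<gamma> \<theta> u v =
     (LEAST c. \<exists>n m. c = \<gamma> * real n + \<theta> * real m \<and> transforms A u n m v)"

(* The elements of BijGroup L are undefined outside L, so that they correspond exactly to the
   bijections from L to L. *)
definition Isom :: "('a \<Rightarrow> 'a \<Rightarrow> real) \<Rightarrow> 'a set \<Rightarrow> ('a \<Rightarrow> 'a) monoid" where
  "Isom d L = (BijGroup L)\<lparr>carrier :=
     {\<phi> \<in> carrier (BijGroup L). \<forall>u\<in>L. \<forall>v\<in>L. d (\<phi> u) (\<phi> v) = d u v}\<rparr>"

lemma group_Isom: "group (Isom d L)"
proof -
  let ?H = "{\<phi> \<in> carrier (BijGroup L). \<forall>u\<in>L. \<forall>v\<in>L. d (\<phi> u) (\<phi> v) = d u v}"
  interpret group "BijGroup L" by (rule group_BijGroup)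
  have "subgroup ?H (BijGroup L)"
  proof (rule subgroupI)
    show "?H \<noteq> {}"
      using one_closed by (auto simp: BijGroup_def)
  next
    fix f assume f: "f \<in> ?H"
    then have fB: "f \<in> Bij L" by (simp add: BijGroup_def)
    then have bij: "bij_betw f L L" by (simp add: Bij_def)
    have "d (inv_into L f u) (inv_into L f v) = d u v" if "u \<in> L" "v \<in> L" for u v
    proof -
      have "inv_into L f u \<in> L" "inv_into L f v \<in> L"
        using that bij by (auto simp: bij_betw_def intro: inv_into_into)
      moreover have "f (inv_into L f u) = u" "f (inv_into L f v) = v"
        using that bij by (auto simp: bij_betw_def f_inv_into_f)
      ultimately show ?thesis using f by (metis (mono_tags, lifting) mem_Collect_eq)
    qed
    moreover have "inv\<^bsub>BijGroup L\<^esub> f = (\<lambda>x\<in>L. inv_into L f x)"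
      using fB by (rule inv_BijGroup)
    moreover have "inv\<^bsub>BijGroup L\<^esub> f \<in> carrier (BijGroup L)"
      using f by simp
    ultimately show "inv\<^bsub>BijGroup L\<^esub> f \<in> ?H" by simp
  next
    fix f g assume fg: "f \<in> ?H" "g \<in> ?H"
    then have B: "f \<in> Bij L" "g \<in> Bij L" by (auto simp: BijGroup_def)
    have "f \<otimes>\<^bsub>BijGroup L\<^esub> g = compose L f g"
      using B by (simp add: BijGroup_def)
    moreover have "f \<otimes>\<^bsub>BijGroup L\<^esub> g \<in> carrier (BijGroup L)"
      using fg by simp
    moreover have "g u \<in> L" if "u \<in> L" for u
      using B(2) that by (auto simp: Bij_def bij_betw_def)
    ultimately show "f \<otimes>\<^bsub>BijGroup L\<^esub> g \<in> ?H"
      using fg by (simp add: compose_def)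
  qed auto
  then show ?thesis
    unfolding Isom_def by (rule subgroup_imp_group)
qed

lemma transforms_delete_all:
  assumes "u \<in> lists A" "w \<in> lists A" "transforms A u n m w"
  shows "transforms A u (n + length w) m []"
  using assms(2,3)
proof (induction w arbitrary: n rule: list.induct)
  case (Cons a w)
  have "indel A ([] @ a # w) ([] @ w)" by (rule deletion) (use Cons.prems in simp_all)
  then have "transforms A u (Suc n) m w" using Cons.prems transforms.indel by fastforce
  then show ?case using Cons.IH[of "Suc n"] Cons.prems by simp
qed simp

lemma transforms_insert_all:
  assumes "transforms A u n m []" "v \<in> lists A"
  shows "transforms A u (n + length v) m v"
  using assms(2)
proof (induction v rule: list.induct)
  case Nil
  then show ?case using assms by simp
next
  case (Cons a v)
  have "indel A ([] @ v) ([] @ a # v)" by (rule insertion) (use Cons.prems in simp_all)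
  then show ?case using Cons transforms.indel by fastforce
qed

lemma lev_attained:
  assumes "\<gamma> > 0" "\<theta> > 0" "u \<in> lists A" "v \<in> lists A"
  shows "\<exists>n m. lev A \<gamma> \<theta> u v = \<gamma> * real n + \<theta> * real m \<and> transforms A u n m v" (is ?attained)
    and "transforms A u n m v \<Longrightarrow> lev A \<gamma> \<theta> u v \<le> \<gamma> * real n + \<theta> * real m"
proof -
  define C where "C = {\<gamma> * real n + \<theta> * real m | n m. transforms A u n m v}"
  obtain n0 m0 where "transforms A u n0 m0 v"
    using transforms_insert_all[OF transforms_delete_all[OF assms(3,3) transforms.refl[OF assms(3)]]
        assms(4)] by blast
  then have c0: "\<gamma> * real n0 + \<theta> * real m0 \<in> C" by (auto simp: C_def)
  define c0 where "c0 = \<gamma> * real n0 + \<theta> * real m0"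
  define D where "D = C \<inter> {..c0}"
  have "D \<subseteq> (\<lambda>(n, m). \<gamma> * real n + \<theta> * real m) ` ({..nat \<lfloor>c0 / \<gamma>\<rfloor>} \<times> {..nat \<lfloor>c0 / \<theta>\<rfloor>})"
  proof
    fix c assume "c \<in> D"
    then obtain n m where c: "c = \<gamma> * real n + \<theta> * real m" "c \<le> c0"
      by (auto simp: D_def C_def)
    have "0 \<le> \<gamma> * real n" "0 \<le> \<theta> * real m" using assms by auto
    then have "\<gamma> * real n \<le> c0" "\<theta> * real m \<le> c0" using c by linarith+
    then have "real n \<le> c0 / \<gamma>" "real m \<le> c0 / \<theta>"
      using assms by (auto simp: pos_le_divide_eq mult.commute)
    then have "n \<le> nat \<lfloor>c0 / \<gamma>\<rfloor>" "m \<le> nat \<lfloor>c0 / \<theta>\<rfloor>"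
      using le_nat_floor by auto
    then show "c \<in> (\<lambda>(n, m). \<gamma> * real n + \<theta> * real m) `
        ({..nat \<lfloor>c0 / \<gamma>\<rfloor>} \<times> {..nat \<lfloor>c0 / \<theta>\<rfloor>})"
      using c by auto
  qed
  then have fin: "finite D" by (rule finite_subset) auto
  have ne: "D \<noteq> {}" using c0 by (auto simp: D_def c0_def)
  have inC: "Min D \<in> C" using Min_in[OF fin ne] by (simp add: D_def)
  have "Min D \<le> c0" using Min_in[OF fin ne] by (simp add: D_def)
  then have least: "Min D \<le> c" if "c \<in> C" for c
    using that fin by (cases "c \<le> c0") (auto simp: D_def)
  have lev: "lev A \<gamma> \<theta> u v = Min D"
    unfolding lev_def using inC least by (intro Least_equality) (auto simp: C_def)
  show ?attained using inC unfolding lev by (auto simp: C_def)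
  show "lev A \<gamma> \<theta> u v \<le> \<gamma> * real n + \<theta> * real m" if "transforms A u n m v"
    unfolding lev using that by (intro least) (auto simp: C_def)
qed

end

(* Fix u in L. If the words phi u had unbounded length, Higman's lemma would yield isometries phi, psi
   such that v = phi u is a subword of v' = psi u, with |v| large and |v'| > 2|v| + |u|. Then
   d(v,v') = gamma (|v'| - |v|). Applying the inverse of phi to u, v, v' gives y, u, z, where y has
   length about |v| and z has length at most about |v'| - |v|. Since a replacement is cheaper than a deletion
   followed by an insertion, d(y,z) is smaller than gamma (|y| + |z|) by a positive multiple of |v|, up
   to a constant. But d(y,z) = d(u,v'), which is gamma |v'| up to a constant: a contradiction.
   Once the orbit of u is bounded, comparing d(w,u) with d(phi w, phi u) bounds the change of length
   of every w. *)

theory Submission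
  imports Defs "HOL-Library.Sublist" "HOL-Library.Infinite_Set"
begin

section \<open>Higman's lemma over a finite alphabet\<close>

text \<open>The usual term of well-quasi-order theory: a counterexample to Higman's lemma.\<close>

definition bad_sequence :: "'a set \<Rightarrow> (nat \<Rightarrow> 'a list) \<Rightarrow> bool" where
  "bad_sequence A f \<longleftrightarrow> (\<forall>i. f i \<in> lists A) \<and> (\<forall>i j. i < j \<longrightarrow> \<not> subseq (f i) (f j))"

text \<open>Nash-Williams' construction: terms are fixed one after another, each as short as
  possible among the bad sequences that continue the terms already fixed.\<close>

lemma bad_sequence_minimal:
  assumes "bad_sequence A f"
  shows "\<exists>m. bad_sequence A m \<and>
    (\<forall>n g. bad_sequence A g \<longrightarrow> (\<forall>i<n. g i = m i) \<longrightarrow> length (m n) \<le> length (g n))"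
proof -
  define P where "P n f \<longleftrightarrow> bad_sequence A f \<and>
    (\<forall>g. bad_sequence A g \<longrightarrow> (\<forall>i<n. g i = f i) \<longrightarrow> length (f n) \<le> length (g n))" for n f
  have ex: "\<exists>f'. P n f' \<and> (\<forall>i<n. f' i = f i)" if "bad_sequence A f" for n f
  proof -
    obtain f' where f': "bad_sequence A f'" "\<forall>i<n. f' i = f i"
      and min: "\<forall>g. bad_sequence A g \<and> (\<forall>i<n. g i = f i) \<longrightarrow> length (f' n) \<le> length (g n)"
      using \<open>bad_sequence A f\<close>
        ex_has_least_nat[of "\<lambda>g. bad_sequence A g \<and> (\<forall>i<n. g i = f i)" f "\<lambda>g. length (g n)"]
      by blast
    have "length (f' n) \<le> length (g n)" if "bad_sequence A g" "\<forall>i<n. g i = f' i" for g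
      using min f'(2) that by simp
    then show ?thesis unfolding P_def using f' by blast
  qed
  \<comment> \<open>Each \<open>F n\<close> is a whole bad sequence. Its terms up to index
    \<open>n\<close> never change afterwards, so the diagonal \<open>F n n\<close> is the
    limit.\<close>
  obtain F where F: "P n (F n)" "\<forall>i<Suc n. F (Suc n) i = F n i" for n
  proof (rule dependent_nat_choice[of P "\<lambda>n f f'. \<forall>i<Suc n. f' i = f i", THEN exE])
    show "\<exists>f. P 0 f" using ex[OF assms, of 0] by auto
    show "\<exists>f'. P (Suc n) f' \<and> (\<forall>i<Suc n. f' i = f i)" if "P n f" for f n
      using ex[of f "Suc n"] that by (auto simp: P_def)
  qed blast
  have agree: "F (n + k) i = F n i" if "i \<le> n" for n k i
    by (induction k) (use F(2) that in auto)
  have diag: "F n i = F i i" if "i \<le> n" for n i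
    using agree[of i i "n - i"] that by simp
  show ?thesis
  proof (intro exI[of _ "\<lambda>n. F n n"] conjI allI impI)
    have bad: "bad_sequence A (F n)" for n using F(1) by (simp add: P_def)
    \<comment> \<open>Badness concerns two terms at a time, and both occur in the bad sequence
      \<open>F j\<close>.\<close>
    have "\<not> subseq (F i i) (F j j)" if "i < j" for i j
      using bad[of j] diag[of i j] that unfolding bad_sequence_def by (metis less_imp_le)
    then show "bad_sequence A (\<lambda>n. F n n)" using bad by (auto simp: bad_sequence_def)
    show "length (F n n) \<le> length (g n)" if "bad_sequence A g" "\<forall>i<n. g i = F i i" for n g
    proof -
      have "\<forall>i<n. g i = F n i" using that(2) diag[of _ n] by simp
      then show ?thesis using F(1)[of n] that(1) by (auto simp: P_def)
    qed
  qed
qed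

text \<open>Infinitely many words of a minimal bad sequence share a first letter. Removing it from
  them, and dropping all other words from the first of them on, would give a bad sequence that
  contradicts minimality.\<close>

theorem higman_lists:
  fixes f :: "nat \<Rightarrow> 'a list"
  assumes "finite A" "\<And>i. f i \<in> lists A"
  obtains i j where "i < j" "subseq (f i) (f j)"
proof (rule ccontr)
  assume "\<not> thesis"
  then have "bad_sequence A f" using assms(2) that by (auto simp: bad_sequence_def)
  then obtain m where bad: "bad_sequence A m"
    and min: "\<And>n g. bad_sequence A g \<Longrightarrow> \<forall>i<n. g i = m i \<Longrightarrow> length (m n) \<le> length (g n)"
    using bad_sequence_minimal by blast
  have lists: "m i \<in> lists A" for i using bad by (simp add: bad_sequence_def)
  have incomp: "\<not> subseq (m i) (m j)" if "i < j" for i j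
    using bad that by (simp add: bad_sequence_def)
  \<comment> \<open>The empty word would embed in its successor.\<close>
  have ne: "m i \<noteq> []" for i using incomp[of i "Suc i"] by auto
  have "hd (m i) \<in> A" for i using lists[of i] ne[of i] by (cases "m i") auto
  then have "finite (range (\<lambda>i. hd (m i)))" by (intro finite_subset[OF _ assms(1)]) auto
  then obtain i0 where "infinite {i \<in> UNIV. hd (m i) = hd (m i0)}"
    using pigeonhole_infinite[of "UNIV :: nat set" "\<lambda>i. hd (m i)"] by auto
  then obtain r :: "nat \<Rightarrow> nat" where r: "strict_mono r" "\<And>k. hd (m (r k)) = hd (m i0)"
    using infinite_enumerate by (metis (mono_tags, lifting) mem_Collect_eq)
  define a where "a = hd (m i0)"
  have cons: "m (r k) = a # tl (m (r k))" for k
    using ne[of "r k"] r(2)[of k] by (cases "m (r k)") (auto simp: a_def)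
  define h where "h i = (if i < r 0 then m i else tl (m (r (i - r 0))))" for i
  have "bad_sequence A h"
    unfolding bad_sequence_def
  proof (intro conjI allI impI)
    fix i
    have "tl (m (r k)) \<in> lists A" for k using lists[of "r k"] cons[of k] by (metis Cons_in_lists_iff)
    then show "h i \<in> lists A" using lists by (auto simp: h_def)
  next
    fix i j :: nat assume "i < j"
    consider "j < r 0" | "i < r 0" "r 0 \<le> j" | "r 0 \<le> i" by linarith
    then show "\<not> subseq (h i) (h j)"
    proof cases
      case 1
      then show ?thesis using \<open>i < j\<close> incomp by (simp add: h_def)
    next
      case 2
      \<comment> \<open>A word that embeds in the tail also embeds in the whole word, which
        \<open>incomp\<close> excludes.\<close>
      have "i < r (j - r 0)"
        using 2 strict_mono_less_eq[OF r(1), of 0 "j - r 0"] by simp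
      then have "\<not> subseq (m i) (a # tl (m (r (j - r 0))))"
        using incomp cons by metis
      then have "\<not> subseq (m i) (tl (m (r (j - r 0))))" by auto
      then show ?thesis using 2 by (simp add: h_def)
    next
      case 3
      \<comment> \<open>Prepending \<open>a\<close> to both tails would turn an embedding between
        them into one between two terms of \<open>m\<close>.\<close>
      have "r (i - r 0) < r (j - r 0)"
        using 3 \<open>i < j\<close> by (intro strict_monoD[OF r(1)]) simp
      then have "\<not> subseq (a # tl (m (r (i - r 0)))) (a # tl (m (r (j - r 0))))"
        using incomp cons by metis
      then show ?thesis using 3 \<open>i < j\<close> by (simp add: h_def)
    qed
  qed
  \<comment> \<open>\<open>h\<close> agrees with \<open>m\<close> before index \<open>r 0\<close>,
    and its term at \<open>r 0\<close> is one letter shorter.\<close>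
  then have "length (m (r 0)) \<le> length (h (r 0))" by (rule min) (simp add: h_def)
  then show False using ne[of "r 0"] by (cases "m (r 0)") (simp_all add: h_def)
qed

section \<open>Estimates for the Levenshtein distance\<close>

lemma transforms_length:
  assumes "transforms A u n m v"
  shows "length u \<le> length v + n \<and> length v \<le> length u + n"
  using assms
  by induction (auto elim!: indel.cases replacement.cases)

text \<open>A common first letter can be carried along through every step; this drives the
  letter-by-letter inductions.\<close>

lemma transforms_Cons:
  assumes "transforms A u n m v" "a \<in> A"
  shows "transforms A (a # u) n m (a # v)"
  using assms(1)
proof induction
  case refl
  then show ?case using assms(2) by (intro transforms.refl) simp
next
  case (indel n m v w)
  from indel.hyps(2) have "indel A (a # v) (a # w)"
  proof cases
    case (insertion xs ys b)
    then show ?thesis using indel.insertion[of "a # xs" A ys b] assms(2) by simp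
  next
    case (deletion xs ys b)
    then show ?thesis using indel.deletion[of "a # xs" A ys b] assms(2) by simp
  qed
  then show ?case using indel.IH by (rule transforms.indel[rotated])
next
  case (replacement n m v w)
  from replacement.hyps(2) have "replacement A (a # v) (a # w)"
  proof cases
    case (1 xs ys b c)
    then show ?thesis using replacement.intros[of "a # xs" A ys b c] assms(2) by simp
  qed
  then show ?case using replacement.IH by (rule transforms.replacement[rotated])
qed

text \<open>Words are aligned at the left. Letters at common positions are replaced, possibly by
  themselves, so that the count is exact; the rest is deleted or inserted. At least one of the
  truncated differences is 0.\<close>

lemma transforms_letterwise:
  assumes "u \<in> lists A" "v \<in> lists A"
  shows "transforms A u ((length u - length v) + (length v - length u))
           (min (length u) (length v)) v"
  using assms
proof (induction u arbitrary: v rule: list.induct)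
  case Nil
  then show ?case using transforms_insert_all[OF transforms.refl] by fastforce
next
  case (Cons a u)
  show ?case
  proof (cases v)
    case Nil
    have au: "a # u \<in> lists A" using Cons.prems by simp
    show ?thesis
      using transforms_delete_all[OF au au transforms.refl[OF au]] Nil by simp
  next
    case (Cons b v')
    have A: "a \<in> A" "b \<in> A" "v' \<in> lists A" "u \<in> lists A" using Cons.prems Cons by auto
    have "replacement A ([] @ a # v') ([] @ b # v')"
      using A by (intro replacement.intros) auto
    then show ?thesis
      using transforms.replacement[OF transforms_Cons[OF Cons.IH[OF A(4,3)] A(1)]] Cons by simp
  qed
qed

text \<open>Only the letters of \<open>v\<close> outside an embedded copy of \<open>u\<close> have
  to be inserted.\<close>

lemma transforms_subseq:
  assumes "subseq u v" "v \<in> lists A"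
  shows "transforms A u (length v - length u) 0 v"
  using assms
proof (induction rule: list_emb.induct)
  case (list_emb_Nil v)
  then show ?case using transforms_insert_all[OF transforms.refl] by fastforce
next
  case (list_emb_Cons u v b)
  have "indel A ([] @ v) ([] @ b # v)"
    using list_emb_Cons.prems by (intro indel.insertion) auto
  moreover have "length u \<le> length v" using list_emb_Cons.hyps by (rule list_emb_length)
  ultimately show ?case
    using transforms.indel[of A u "length v - length u" 0 v "b # v"] list_emb_Cons
    by (simp add: Suc_diff_le)
next
  case (list_emb_Cons2 a b u v)
  then show ?case using transforms_Cons[of A u _ 0 v b] by simp
qed

text \<open>Only insertions and deletions change the length, each by one.\<close>

lemma lev_ge:
  assumes "\<gamma> > 0" "\<theta> > 0" "u \<in> lists A" "v \<in> lists A"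
  shows "\<gamma> * \<bar>real (length u) - real (length v)\<bar> \<le> lev A \<gamma> \<theta> u v"
proof -
  obtain n m where nm: "lev A \<gamma> \<theta> u v = \<gamma> * real n + \<theta> * real m" "transforms A u n m v"
    using lev_attained(1)[OF assms] by blast
  have "\<bar>real (length u) - real (length v)\<bar> \<le> real n" using transforms_length[OF nm(2)] by linarith
  then have "\<gamma> * \<bar>real (length u) - real (length v)\<bar> \<le> \<gamma> * real n" using assms(1) by simp
  moreover have "0 \<le> \<theta> * real m" using assms(2) by simp
  ultimately show ?thesis using nm(1) by linarith
qed

lemma lev_le:
  assumes "\<gamma> > 0" "\<theta> > 0" "u \<in> lists A" "v \<in> lists A"
  shows "lev A \<gamma> \<theta> u v \<le> \<gamma> * \<bar>real (length u) - real (length v)\<bar>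
           + \<theta> * min (real (length u)) (real (length v))"
proof -
  have "real ((length u - length v) + (length v - length u))
      = \<bar>real (length u) - real (length v)\<bar>" by linarith
  moreover have "real (min (length u) (length v)) = min (real (length u)) (real (length v))"
    by linarith
  ultimately show ?thesis
    using lev_attained(2)[OF assms transforms_letterwise[OF assms(3,4)]] by simp
qed

lemma lev_subseq_le:
  assumes "\<gamma> > 0" "\<theta> > 0" "v \<in> lists A" "subseq u v"
  shows "lev A \<gamma> \<theta> u v \<le> \<gamma> * (real (length v) - real (length u))"
proof -
  have "u \<in> lists A" using assms(3,4) by (auto elim: list_emb_set)
  then show ?thesis
    using lev_attained(2)[OF assms(1,2) _ assms(3) transforms_subseq[OF assms(4,3)]]
      list_emb_length[OF assms(4)] by (simp add: of_nat_diff)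
qed

section \<open>Orbits of isometries\<close>

lemma Isom_bij_betw: "\<phi> \<in> carrier (Isom d L) \<Longrightarrow> bij_betw \<phi> L L"
  by (simp add: Isom_def BijGroup_def Bij_def)

lemma Isom_dist:
  "\<phi> \<in> carrier (Isom d L) \<Longrightarrow> u \<in> L \<Longrightarrow> v \<in> L \<Longrightarrow> d (\<phi> u) (\<phi> v) = d u v"
  by (simp add: Isom_def)

lemma Isom_preimage:
  assumes "\<phi> \<in> carrier (Isom d L)" "v \<in> L"
  obtains u where "u \<in> L" "\<phi> u = v"
proof -
  have "v \<in> \<phi> ` L" using bij_betw_imp_surj_on[OF Isom_bij_betw[OF assms(1)]] assms(2) by simp
  then show thesis using that by auto
qed

text \<open>The distance from \<open>u\<close> to \<open>v'\<close> is estimated from below by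
  lengths and from above through preimages under \<open>\<phi>\<close>. The length of
  \<open>v'\<close> cancels, which leaves a bound on \<open>\<phi> u\<close>.\<close>

lemma Isom_subword_image_bound:
  fixes \<gamma> \<theta> :: real
  assumes L: "L \<subseteq> lists A" and \<gamma>: "\<gamma> > 0" and \<theta>: "\<theta> > 0" "\<theta> < 2 * \<gamma>"
    and \<phi>: "\<phi> \<in> carrier (Isom (lev A \<gamma> \<theta>) L)"
    and u: "u \<in> L" and v': "v' \<in> L" and sub: "subseq (\<phi> u) v'"
    and long: "2 * length (\<phi> u) + length u \<le> length v'"
  shows "(2 * \<gamma> - max \<theta> \<gamma>) * real (length (\<phi> u)) \<le> 4 * \<gamma> * real (length u)"
proof -
  let ?d = "lev A \<gamma> \<theta>"
  \<comment> \<open>Raising \<theta> to at least \<gamma> makes \<open>\<theta>' - \<gamma>\<close>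
    nonnegative, as monotone estimates below require; \<open>\<theta>'\<close> stays below
    2\<gamma>.\<close>
  define \<theta>' where "\<theta>' = max \<theta> \<gamma>"
  define v where "v = \<phi> u"
  obtain y where y: "y \<in> L" "\<phi> y = u" using Isom_preimage[OF \<phi> u] .
  obtain z where z: "z \<in> L" "\<phi> z = v'" using Isom_preimage[OF \<phi> v'] .
  have v: "v \<in> L" using Isom_bij_betw[OF \<phi>] u by (auto simp: v_def bij_betw_def)
  have ge: "\<gamma> * \<bar>real (length s) - real (length t)\<bar> \<le> ?d s t" if "s \<in> L" "t \<in> L" for s t
    by (rule lev_ge[OF \<gamma> \<theta>(1) subsetD[OF L that(1)] subsetD[OF L that(2)]])
  have le: "?d s t \<le> \<gamma> * \<bar>real (length s) - real (length t)\<bar>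
      + \<theta> * min (real (length s)) (real (length t))" if "s \<in> L" "t \<in> L" for s t
    by (rule lev_le[OF \<gamma> \<theta>(1) subsetD[OF L that(1)] subsetD[OF L that(2)]])
  define k n n' p q where "k = real (length u)" and "n = real (length v)"
    and "n' = real (length v')" and "p = real (length y)" and "q = real (length z)"
  note defs = k_def n_def n'_def p_def q_def
  have nonneg: "0 \<le> k" "0 \<le> n" "0 \<le> p" "0 \<le> q" by (simp_all add: defs)
  have long': "2 * n + k \<le> n'" using long by (simp add: defs v_def)
  \<comment> \<open>\<open>z\<close> is as far from \<open>u\<close> as \<open>v'\<close> is from
    \<open>v\<close>, and passing from \<open>v\<close> to \<open>v'\<close> takes insertions
    only.\<close>
  have "\<gamma> * \<bar>k - q\<bar> \<le> \<gamma> * (n' - n)"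
  proof -
    have "?d u z = ?d v v'" using Isom_dist[OF \<phi> u z(1)] z(2) by (simp add: v_def)
    moreover have "?d v v' \<le> \<gamma> * (n' - n)"
      unfolding defs v_def by (rule lev_subseq_le[OF \<gamma> \<theta>(1) subsetD[OF L v'] sub])
    ultimately show ?thesis using ge[OF u z(1)] by (simp add: defs)
  qed
  then have q: "q \<le> n' - n + k" using \<gamma> by simp
  have "\<gamma> * \<bar>p - k\<bar> \<le> \<gamma> * \<bar>k - n\<bar> + \<theta> * min k n"
    using ge[OF y(1) u] Isom_dist[OF \<phi> y(1) u] y(2) le[OF u v] by (simp add: defs v_def)
  \<comment> \<open>With \<theta> enlarged to 2\<gamma> the bound becomes \<gamma> times
    \<open>k + n\<close>.\<close>
  also have "\<dots> \<le> \<gamma> * \<bar>k - n\<bar> + (2 * \<gamma>) * min k n"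
    using \<theta>(2) nonneg by (intro add_left_mono mult_right_mono) auto
  also have "\<dots> = \<gamma> * (\<bar>k - n\<bar> + 2 * min k n)" by (simp add: algebra_simps)
  finally have "\<bar>p - k\<bar> \<le> \<bar>k - n\<bar> + 2 * min k n" using \<gamma> by simp
  then have p: "p \<le> n + 2 * k" using nonneg by linarith
  have "\<gamma> * (n' - k) \<le> \<gamma> * \<bar>k - n'\<bar>" using \<gamma> by simp
  also have "\<dots> \<le> ?d u v'" using ge[OF u v'] by (simp add: defs)
  also have "\<dots> = ?d y z" using Isom_dist[OF \<phi> y(1) z(1)] y(2) z(2) by simp
  also have "\<dots> \<le> \<gamma> * \<bar>p - q\<bar> + \<theta> * min p q" using le[OF y(1) z(1)] by (simp add: defs)
  also have "\<dots> \<le> \<gamma> * \<bar>p - q\<bar> + \<theta>' * min p q"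
    using nonneg by (intro add_left_mono mult_right_mono) (auto simp: \<theta>'_def)
  also have "\<dots> = \<gamma> * max p q + (\<theta>' - \<gamma>) * min p q"
    by (cases "p \<le> q") (simp_all add: algebra_simps)
  \<comment> \<open>\<open>long'\<close> says exactly that \<open>n + 2 * k\<close>, the bound on
    \<open>p\<close>, is at most \<open>n' - n + k\<close>, the bound on \<open>q\<close>; so the
    latter bounds the maximum and the former the minimum.\<close>
  also have "\<dots> \<le> \<gamma> * (n' - n + k) + (\<theta>' - \<gamma>) * (n + 2 * k)"
    using p q long' nonneg \<gamma> by (intro add_mono mult_left_mono) (auto simp: \<theta>'_def)
  finally have "(2 * \<gamma> - \<theta>') * n \<le> (2 * \<theta>') * k"
    by (simp add: algebra_simps)
  also have "\<dots> \<le> (4 * \<gamma>) * k"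
    using nonneg \<theta>(2) \<gamma> by (intro mult_right_mono) (auto simp: \<theta>'_def)
  finally show ?thesis by (simp add: \<theta>'_def defs v_def)
qed

lemma Isom_orbit_bounded:
  fixes \<gamma> \<theta> :: real
  assumes "finite A" "L \<subseteq> lists A" and \<gamma>: "\<gamma> > 0" and \<theta>: "\<theta> > 0" "\<theta> < 2 * \<gamma>"
    and u: "u \<in> L"
  shows "\<exists>K. \<forall>\<phi>\<in>carrier (Isom (lev A \<gamma> \<theta>) L). length (\<phi> u) \<le> K"
proof (rule ccontr)
  let ?G = "carrier (Isom (lev A \<gamma> \<theta>) L)"
  assume "\<not> ?thesis"
  then have unbounded: "\<exists>\<phi>. \<phi> \<in> ?G \<and> K < length (\<phi> u)" for K
    by (meson not_le)
  \<comment> \<open>The largest length that \<open>Isom_subword_image_bound\<close> permits; every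
    orbit word chosen below is longer.\<close>
  define M where "M = nat \<lceil>4 * \<gamma> * real (length u) / (2 * \<gamma> - max \<theta> \<gamma>)\<rceil>"
  have pos: "2 * \<gamma> - max \<theta> \<gamma> > 0" using \<gamma> \<theta> by simp
  obtain \<Phi> where \<Phi>: "\<Phi> i \<in> ?G \<and> M < length (\<Phi> i u)"
    and step: "2 * length (\<Phi> i u) + length u \<le> length (\<Phi> (Suc i) u)" for i
  proof (rule dependent_nat_choice[of "\<lambda>_ \<phi>. \<phi> \<in> ?G \<and> M < length (\<phi> u)"
      "\<lambda>_ \<phi> \<psi>. 2 * length (\<phi> u) + length u \<le> length (\<psi> u)", THEN exE])
    show "\<exists>\<phi>. \<phi> \<in> ?G \<and> M < length (\<phi> u)" by (rule unbounded)
    show "\<exists>\<psi>. (\<psi> \<in> ?G \<and> M < length (\<psi> u)) \<and> 2 * length (\<phi> u) + length u \<le> length (\<psi> u)"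
      if "\<phi> \<in> ?G \<and> M < length (\<phi> u)" for \<phi>
    proof -
      obtain \<psi> where "\<psi> \<in> ?G" "2 * length (\<phi> u) + length u < length (\<psi> u)"
        using unbounded by blast
      then show ?thesis using that by (intro exI[of _ \<psi>]) simp
    qed
  qed blast
  have inL: "\<Phi> i u \<in> L" for i
    using Isom_bij_betw[of "\<Phi> i"] \<Phi>[of i] u by (auto simp: bij_betw_def)
  then have "\<Phi> i u \<in> lists A" for i using assms(2) by blast
  then obtain i j where "i < j" and sub: "subseq (\<Phi> i u) (\<Phi> j u)"
    using higman_lists[OF assms(1), of "\<lambda>i. \<Phi> i u"] by blast
  \<comment> \<open>Lengths never decrease along the sequence, so the gap between consecutive terms
    carries over to the pair \<open>i\<close>, \<open>j\<close> from Higman's lemma.\<close>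
  have "length (\<Phi> (Suc i) u) \<le> length (\<Phi> j u)"
  proof (rule lift_Suc_mono_le[of "\<lambda>i. length (\<Phi> i u)"])
    show "length (\<Phi> n u) \<le> length (\<Phi> (Suc n) u)" for n using step[of n] by linarith
  qed (use \<open>i < j\<close> in simp)
  then have "2 * length (\<Phi> i u) + length u \<le> length (\<Phi> j u)" using step[of i] by linarith
  then have "(2 * \<gamma> - max \<theta> \<gamma>) * real (length (\<Phi> i u)) \<le> 4 * \<gamma> * real (length u)"
    using Isom_subword_image_bound[OF assms(2) \<gamma> \<theta> conjunct1[OF \<Phi>[of i]] u inL[of j] sub] by simp
  then have "real (length (\<Phi> i u)) \<le> 4 * \<gamma> * real (length u) / (2 * \<gamma> - max \<theta> \<gamma>)"
    using pos by (simp add: pos_le_divide_eq mult.commute)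
  then have "length (\<Phi> i u) \<le> M" unfolding M_def by linarith
  then show False using \<Phi>[of i] by simp
qed

theorem theorem1:
  fixes A :: "'a set" and L :: "'a list set" and \<gamma> \<theta> :: real
  assumes "finite A" and "L \<subseteq> lists A"
    and "\<gamma> > 0" and "\<theta> > 0" and "\<theta> < 2 * \<gamma>"
  shows "\<exists>m::nat. \<forall>\<phi>\<in>carrier (Isom (lev A \<gamma> \<theta>) L). \<forall>w\<in>L.
           \<bar>int (length (\<phi> w)) - int (length w)\<bar> \<le> int m"
proof (cases "L = {}")
  case False
  then obtain u where u: "u \<in> L" by blast
  obtain K where K: "\<And>\<phi>. \<phi> \<in> carrier (Isom (lev A \<gamma> \<theta>) L) \<Longrightarrow> length (\<phi> u) \<le> K"
    using Isom_orbit_bounded[OF assms u] by blast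
  \<comment> \<open>Stated for four words so that it serves twice, with the pairs \<open>w\<close>,
    \<open>u\<close> and \<open>\<phi> w\<close>, \<open>\<phi> u\<close> in either role.\<close>
  have diff: "length s \<le> length s' + 3 * length t + length t'"
    if "s \<in> L" "t \<in> L" "s' \<in> L" "t' \<in> L" "lev A \<gamma> \<theta> s t' = lev A \<gamma> \<theta> s' t" for s t s' t'
  proof -
    have "\<gamma> * \<bar>real (length s) - real (length t')\<bar> \<le> lev A \<gamma> \<theta> s' t"
      using lev_ge[of \<gamma> \<theta> s A t'] assms that by auto
    also have "\<dots> \<le> \<gamma> * \<bar>real (length s') - real (length t)\<bar>
        + \<theta> * min (real (length s')) (real (length t))"
      using lev_le[of \<gamma> \<theta> s' A t] assms that by auto
    also have "\<dots> \<le> \<gamma> * \<bar>real (length s') - real (length t)\<bar>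
        + (2 * \<gamma>) * min (real (length s')) (real (length t))"
      using assms(5) by (intro add_left_mono mult_right_mono) auto
    also have "\<dots> = \<gamma> * (\<bar>real (length s') - real (length t)\<bar>
        + 2 * min (real (length s')) (real (length t)))" by (simp add: algebra_simps)
    finally have "\<bar>real (length s) - real (length t')\<bar> \<le> \<bar>real (length s') - real (length t)\<bar>
        + 2 * min (real (length s')) (real (length t))" using assms(3) by simp
    then show ?thesis by linarith
  qed
  show ?thesis
  \<comment> \<open>The length grows by at most \<open>3 * length u + K\<close> and shrinks by at
    most \<open>3 * K + length u\<close>; the witness dominates both.\<close>
  proof (intro exI[of _ "3 * K + 3 * length u"] ballI)
    fix \<phi> w assume \<phi>: "\<phi> \<in> carrier (Isom (lev A \<gamma> \<theta>) L)" and w: "w \<in> L"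
    have inL: "\<phi> u \<in> L" "\<phi> w \<in> L"
      using Isom_bij_betw[OF \<phi>] u w by (auto simp: bij_betw_def)
    have d: "lev A \<gamma> \<theta> (\<phi> w) (\<phi> u) = lev A \<gamma> \<theta> w u" using Isom_dist[OF \<phi> w u] .
    have "length (\<phi> w) \<le> length w + 3 * length u + length (\<phi> u)"
      using diff[OF inL(2) u w inL(1) d] .
    moreover have "length w \<le> length (\<phi> w) + 3 * length (\<phi> u) + length u"
      using diff[OF w inL(1) inL(2) u d[symmetric]] .
    ultimately show "\<bar>int (length (\<phi> w)) - int (length w)\<bar> \<le> int (3 * K + 3 * length u)"
      using K[OF \<phi>] by linarith
  qed
qed simp

end
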